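(* Let $(S,\mu)$ be a $\sigma$-finite measure space, $1<p\le\infty$, $C<\infty$, and let $\mathcal W_{p,C}$ be the set of graphons $W$ on $(S,\mu)$ with $\|W\|_{L^p}\le C$. (i) The set of nonnegative graphons in $\mathcal W_{p,C}$ is complete for the cut norm. Hence a set of nonnegative graphons on $S$ bounded in $L^p$ is relatively complete for the cut norm; in particular the set of $[0,1]$-valued graphons on $S$ is complete for the cut norm. (ii) For every $C_1<\infty$, the set of $W\in\mathcal W_{p,C}$ with $\|W\|_{L^1}\le C_1$ is complete for the cut norm. Hence a set of graphons on $S$ bounded in both $L^1$ and $L^p$ is relatively complete for the cut norm. (iii) If $\mu(S)<\infty$, then $\mathcal W_{p,C}$ is complete for the cut norm; hence any $L^p$-bounded set of graphons on a finite measure space is relatively complete for the cut norm.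
   Context: A graphon on $(S,\mu)$ is a symmetric function $W\in L^1(S\times S,\mu\times\mu)$; functions equal a.e. are identified. Cut norm: $\|F\|_\square:=\sup_{T,U}|\int_{T\times U}F\,d\mu\,d\mu|$ over measurable $T,U\subseteq S$. A set is complete if every Cauchy sequence in it converges to an element of the set; relatively complete if every Cauchy sequence in it converges to some graphon on $S$ (not necessarily in the set). *)

theory Defs
  imports "HOL-Analysis.Analysis"
begin

text \<open>A graphon on (S, mu): a real function on S x S, integrable w.r.t. the
product measure and symmetric. Since graphons are identified when equal a.e.,
symmetry is required almost everywhere (exactly the representatives of
symmetric classes).\<close>
definition graphon :: "'a measure \<Rightarrow> ('a \<times> 'a \<Rightarrow> real) \<Rightarrow> bool" where
  "graphon M W \<longleftrightarrow> integrable (M \<Otimes>\<^sub>M M) W \<and>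
     (AE z in M \<Otimes>\<^sub>M M. W z = W (snd z, fst z))"

text \<open>Cut norm: supremum over measurable T, U of |int_{T x U} F|
(valued in ennreal to avoid junk values of an unbounded real supremum).\<close>
definition cut_norm :: "'a measure \<Rightarrow> ('a \<times> 'a \<Rightarrow> real) \<Rightarrow> ennreal" where
  "cut_norm M F = (SUP TU\<in>sets M \<times> sets M.
      ennreal \<bar>set_lebesgue_integral (M \<Otimes>\<^sub>M M) (fst TU \<times> snd TU) F\<bar>)"

definition Lp_le :: "'a measure \<Rightarrow> ennreal \<Rightarrow> ('a \<Rightarrow> real) \<Rightarrow> real \<Rightarrow> bool" where
  "Lp_le M p f C \<longleftrightarrow> 0 \<le> C \<and>
     (if p = \<infinity> then (AE x in M. \<bar>f x\<bar> \<le> C)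
      else (\<integral>\<^sup>+ x. ennreal (\<bar>f x\<bar> powr enn2real p) \<partial>M) \<le> ennreal (C powr enn2real p))"

definition cut_Cauchy :: "'a measure \<Rightarrow> (nat \<Rightarrow> 'a \<times> 'a \<Rightarrow> real) \<Rightarrow> bool" where
  "cut_Cauchy M Ws \<longleftrightarrow> (\<forall>e>0. \<exists>N. \<forall>m\<ge>N. \<forall>n\<ge>N.
      cut_norm M (\<lambda>z. Ws m z - Ws n z) < ennreal e)"

definition cut_converges :: "'a measure \<Rightarrow> (nat \<Rightarrow> 'a \<times> 'a \<Rightarrow> real) \<Rightarrow> ('a \<times> 'a \<Rightarrow> real) \<Rightarrow> bool" where
  "cut_converges M Ws V \<longleftrightarrow> ((\<lambda>n. cut_norm M (\<lambda>z. Ws n z - V z)) \<longlongrightarrow> 0) sequentially"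

definition cut_complete :: "'a measure \<Rightarrow> ('a \<times> 'a \<Rightarrow> real) set \<Rightarrow> bool" where
  "cut_complete M A \<longleftrightarrow> (\<forall>Ws. (\<forall>n. Ws n \<in> A) \<and> cut_Cauchy M Ws \<longrightarrow>
      (\<exists>V\<in>A. cut_converges M Ws V))"

definition cut_rel_complete :: "'a measure \<Rightarrow> ('a \<times> 'a \<Rightarrow> real) set \<Rightarrow> bool" where
  "cut_rel_complete M A \<longleftrightarrow> (\<forall>Ws. (\<forall>n. Ws n \<in> A) \<and> cut_Cauchy M Ws \<longrightarrow>
      (\<exists>V. graphon M V \<and> cut_converges M Ws V))"

definition Wpc :: "'a measure \<Rightarrow> ennreal \<Rightarrow> real \<Rightarrow> ('a \<times> 'a \<Rightarrow> real) set" where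
  "Wpc M p C = {W. graphon M W \<and> Lp_le (M \<Otimes>\<^sub>M M) p W C}"

end

(* Weak compactness of bounded sets of L^p is replaced by a Komlos argument. Let (W_n) be
   cut-Cauchy and bounded in L^1 and L^p. With w > 0 integrable, almost-minimisers of the strictly
   convex functional f |-> integral of sqrt(w^2 + f^2) over the (weakly closed) convex hulls of the
   tails of (W_n) have a subsequence g_k converging a.e. to some V. Fatou's lemma hands the bounds,
   the sign and the symmetry of the g_k to V. Since p > 1, the g_k are uniformly integrable, so the
   integral of V over a rectangle T x U of finite measure is the limit of those of g_k, hence of
   those of W_n. Therefore |int_{T x U} (W_m - V)| <= liminf_n cut_norm (W_m - W_n), first for finite
   and then, by sigma-finiteness, for all rectangles, and W_m converges to V in cut norm.
   The L^1 bound is automatic for nonnegative W_n (test the cut norm on S x S) and on a finite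
   measure space. *)

theory Submission
  imports Defs
begin

section \<open>Quantitative strict convexity of \<open>sqrt (w\<^sup>2 + t\<^sup>2)\<close>\<close>

text \<open>Plane geometry of u = (w, a) and v = (w, b): \<open>A\<close> and \<open>B\<close> are
  their lengths, \<open>m\<close> is the length of their midpoint, and \<open>Q\<close> is the
  Cauchy-Schwarz defect |u| |v| - u.v. Expanding squares gives (S/2 - m) (S/2 + m) = Q/2, and
  Lagrange's identity gives Q (|u| |v| + u.v) = det(u, v)^2 = w^2 (a - b)^2. Bounding the cofactors
  by powers of \<open>S\<close> finishes.\<close>

lemma sqrt_midpoint_gap:
  fixes a b w :: real
  defines "S \<equiv> sqrt (w\<^sup>2 + a\<^sup>2) + sqrt (w\<^sup>2 + b\<^sup>2)"
  shows "sqrt (w\<^sup>2 + ((a + b) / 2)\<^sup>2) \<le> S / 2"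
    and "w\<^sup>2 * (a - b)\<^sup>2 \<le> (S / 2 - sqrt (w\<^sup>2 + ((a + b) / 2)\<^sup>2)) * S ^ 3"
proof -
  define A where "A = sqrt (w\<^sup>2 + a\<^sup>2)"
  define B where "B = sqrt (w\<^sup>2 + b\<^sup>2)"
  define m where "m = sqrt (w\<^sup>2 + ((a + b) / 2)\<^sup>2)"
  define Q where "Q = A * B - (w\<^sup>2 + a * b)"
  have nn: "0 \<le> A" "0 \<le> B" "0 \<le> m"
    by (simp_all add: A_def B_def m_def)
  have sq: "A\<^sup>2 = w\<^sup>2 + a\<^sup>2" "B\<^sup>2 = w\<^sup>2 + b\<^sup>2" "m\<^sup>2 = w\<^sup>2 + ((a + b) / 2)\<^sup>2"
    by (simp_all add: A_def B_def m_def)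
  have S: "S = A + B" by (simp add: S_def A_def B_def)
  have AB2: "(A * B)\<^sup>2 = (w\<^sup>2 + a * b)\<^sup>2 + w\<^sup>2 * (a - b)\<^sup>2"
    unfolding power_mult_distrib sq by (simp add: power2_eq_square algebra_simps)
  have le: "\<bar>w\<^sup>2 + a * b\<bar> \<le> A * B"
    by (rule abs_le_square_iff[THEN iffD2, of _ "A * B", unfolded abs_of_nonneg[OF mult_nonneg_nonneg[OF nn(1,2)]]])
       (simp add: AB2)
  then have Q0: "0 \<le> Q" by (simp add: Q_def)
  have gap: "(S / 2 - m) * (S / 2 + m) = Q / 2"
    using sq unfolding S Q_def by (simp add: power2_eq_square field_simps)
  have mS: "m \<le> S / 2"
  proof (rule ccontr)
    assume "\<not> m \<le> S / 2"
    then have "(S / 2 - m) * (S / 2 + m) < 0"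
      using nn S by (intro mult_neg_pos; linarith)
    with gap Q0 show False by simp
  qed
  then show "sqrt (w\<^sup>2 + ((a + b) / 2)\<^sup>2) \<le> S / 2" by (simp add: m_def)
  have "w\<^sup>2 * (a - b)\<^sup>2 = Q * (A * B + (w\<^sup>2 + a * b))"
    using AB2 unfolding Q_def by (simp add: power2_eq_square algebra_simps)
  also have "\<dots> \<le> Q * (S\<^sup>2 / 2)"
  proof (rule mult_left_mono[OF _ Q0])
    have "A * B + (w\<^sup>2 + a * b) \<le> 2 * (A * B)" using le by simp
    also have "\<dots> \<le> S\<^sup>2 / 2"
      using zero_le_power2[of "A - B"] unfolding S by (simp add: power2_eq_square algebra_simps)
    finally show "A * B + (w\<^sup>2 + a * b) \<le> S\<^sup>2 / 2" .
  qed
  also have "\<dots> = ((S / 2 - m) * (S / 2 + m)) * S\<^sup>2" by (simp add: gap)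
  also have "\<dots> \<le> ((S / 2 - m) * S) * S\<^sup>2"
    using mS by (intro mult_right_mono mult_left_mono) auto
  finally show "w\<^sup>2 * (a - b)\<^sup>2 \<le> (S / 2 - sqrt (w\<^sup>2 + ((a + b) / 2)\<^sup>2)) * S ^ 3"
    by (simp add: m_def power2_eq_square power3_eq_cube mult.assoc)
qed

text \<open>Each summand handles one case: \<open>S / R\<close> when \<open>S\<close> is large
  compared with \<open>w\<close>, \<open>e * w\<close> when a and b are close, and the gap term
  otherwise. After integration the first two are made small by the choice of \<open>e\<close> and
  \<open>R\<close>, the third by almost-minimality.\<close>

lemma min_diff_le_sqrt_midpoint_gap:
  fixes a b w e R :: real
  defines "S \<equiv> sqrt (w\<^sup>2 + a\<^sup>2) + sqrt (w\<^sup>2 + b\<^sup>2)"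
  assumes w: "0 < w" and e: "0 < e" and R: "0 < R"
  shows "min w \<bar>a - b\<bar> \<le> e * w + S / R + R ^ 3 / e * (S / 2 - sqrt (w\<^sup>2 + ((a + b) / 2)\<^sup>2))"
proof -
  define d where "d = S / 2 - sqrt (w\<^sup>2 + ((a + b) / 2)\<^sup>2)"
  have d0: "0 \<le> d" and gap: "w\<^sup>2 * (a - b)\<^sup>2 \<le> d * S ^ 3"
    using sqrt_midpoint_gap[of w a b] by (simp_all add: d_def S_def)
  have S0: "0 \<le> S" by (simp add: S_def)
  have nn: "0 \<le> e * w" "0 \<le> S / R" "0 \<le> R ^ 3 / e * d"
    using w e R d0 S0 by simp_all
  consider "R * w < S" | "\<bar>a - b\<bar> \<le> e * w" | "S \<le> R * w" "e * w < \<bar>a - b\<bar>" by linarith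
  then show ?thesis
  proof cases
    case 1
    then have "w \<le> S / R" using R by (simp add: field_simps)
    with nn show ?thesis unfolding d_def[symmetric] by linarith
  next
    case 2
    with nn show ?thesis unfolding d_def[symmetric] by linarith
  next
    case 3
    \<comment> \<open>One factor |a - b| is traded for \<open>e * w\<close> and \<open>S\<close> is
      bounded by \<open>R * w\<close>, so that \<open>w ^ 3\<close> appears on both sides and
      cancels.\<close>
    have "w\<^sup>2 * (\<bar>a - b\<bar> * (e * w)) \<le> w\<^sup>2 * (\<bar>a - b\<bar> * \<bar>a - b\<bar>)"
      using 3 by (intro mult_left_mono) auto
    also have "\<dots> = w\<^sup>2 * (a - b)\<^sup>2" by (simp add: power2_eq_square)
    also have "\<dots> \<le> d * (R * w) ^ 3"
      using gap by (rule order_trans) (intro mult_left_mono power_mono 3 S0 d0)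
    finally have "w ^ 3 * (\<bar>a - b\<bar> * e) \<le> w ^ 3 * (R ^ 3 * d)"
      by (simp add: power2_eq_square power3_eq_cube algebra_simps)
    then have "\<bar>a - b\<bar> * e \<le> R ^ 3 * d" using w by simp
    then have "\<bar>a - b\<bar> \<le> R ^ 3 / e * d" using e by (simp add: field_simps)
    with nn show ?thesis unfolding d_def[symmetric] by linarith
  qed
qed

section \<open>Almost everywhere convergence by a Komlos argument\<close>

text \<open>The truncated increments have a finite sum at almost every x, hence tend to 0 there and
  eventually fall below \<open>w x\<close> > 0. From then on the minimum is the increment itself, so
  the increments are absolutely summable and telescope.\<close>

lemma AE_convergent_if_summable_truncated_increments:
  fixes g :: "nat \<Rightarrow> 'a \<Rightarrow> real" and w :: "'a \<Rightarrow> real"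
  assumes [measurable]: "\<And>k. g k \<in> borel_measurable N" "w \<in> borel_measurable N"
    and w: "\<And>x. 0 < w x"
    and le: "\<And>k. (\<integral>\<^sup>+x. ennreal (min (w x) \<bar>g (Suc k) x - g k x\<bar>) \<partial>N) \<le> ennreal ((1/2) ^ k)"
  shows "AE x in N. convergent (\<lambda>k. g k x)"
proof -
  define m where "m k x = min (w x) \<bar>g (Suc k) x - g k x\<bar>" for k x
  have [measurable]: "m k \<in> borel_measurable N" for k unfolding m_def by measurable
  have m0: "0 \<le> m k x" for k x using w[of x] by (simp add: m_def)
  have "(\<integral>\<^sup>+x. (\<Sum>k. ennreal (m k x)) \<partial>N) = (\<Sum>k. \<integral>\<^sup>+x. ennreal (m k x) \<partial>N)"
    by (rule nn_integral_suminf) measurable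
  also have "\<dots> \<le> (\<Sum>k. ennreal ((1/2) ^ k))"
    using le unfolding m_def by (intro suminf_le) auto
  also have "\<dots> < \<infinity>"
    by (subst suminf_ennreal2) (auto simp: summable_geometric)
  finally have "AE x in N. (\<Sum>k. ennreal (m k x)) \<noteq> \<infinity>"
    by (intro nn_integral_PInf_AE) auto
  then show ?thesis
  proof eventually_elim
    case (elim x)
    then have sm: "summable (\<lambda>k. m k x)"
      using m0 by (intro summable_suminf_not_top) auto
    then have "(\<lambda>k. m k x) \<longlonglongrightarrow> 0" by (rule summable_LIMSEQ_zero)
    then have "\<forall>\<^sub>F k in sequentially. m k x < w x"
      using w[of x] by (rule order_tendstoD(2))
    then have "\<forall>\<^sub>F k in sequentially. norm (g (Suc k) x - g k x) = m k x"
      by eventually_elim (auto simp: m_def)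
    then have "summable (\<lambda>k. norm (g (Suc k) x - g k x))"
      using sm by (subst summable_cong)
    then have "summable (\<lambda>k. g (Suc k) x - g k x)" by (rule summable_norm_cancel)
    then show ?case by (simp add: summable_iff_convergent sum_lessThan_telescope[of "\<lambda>k. g k x"] convergent_diff_const_right_iff)
  qed
qed

lemma integrable_sqrt_sum_squares:
  fixes f w :: "'a \<Rightarrow> real"
  assumes "integrable N w" "integrable N f"
  shows "integrable N (\<lambda>x. sqrt ((w x)\<^sup>2 + (f x)\<^sup>2))"
    and "(\<integral>x. sqrt ((w x)\<^sup>2 + (f x)\<^sup>2) \<partial>N) \<le> (\<integral>x. \<bar>w x\<bar> \<partial>N) + (\<integral>x. \<bar>f x\<bar> \<partial>N)"
proof -
  note [measurable] = borel_measurable_integrable[OF assms(1)] borel_measurable_integrable[OF assms(2)]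
  have i: "integrable N (\<lambda>x. \<bar>w x\<bar> + \<bar>f x\<bar>)" using assms by auto
  show *: "integrable N (\<lambda>x. sqrt ((w x)\<^sup>2 + (f x)\<^sup>2))"
    by (rule Bochner_Integration.integrable_bound[OF i]) (auto simp: sqrt_sum_squares_le_sum_abs)
  have "(\<integral>x. sqrt ((w x)\<^sup>2 + (f x)\<^sup>2) \<partial>N) \<le> (\<integral>x. \<bar>w x\<bar> + \<bar>f x\<bar> \<partial>N)"
    using * i by (rule integral_mono) (rule sqrt_sum_squares_le_sum_abs)
  then show "(\<integral>x. sqrt ((w x)\<^sup>2 + (f x)\<^sup>2) \<partial>N) \<le> (\<integral>x. \<bar>w x\<bar> \<partial>N) + (\<integral>x. \<bar>f x\<bar> \<partial>N)"
    using assms by simp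
qed

text \<open>The infima \<open>I n\<close> of \<Phi> over the sets \<open>T n\<close> increase to a
  finite \<open>L\<close>. For n \<le> m the midpoint of \<open>f m\<close> and \<open>f n\<close>
  lies in \<open>T n\<close>, so its \<Phi> is at least \<open>I n\<close>, and the integrated
  convexity gap is at most \<open>\<eta> n\<close>, which tends to 0. The pointwise gap estimate
  makes \<open>f\<close> Cauchy for the truncated L^1 distance, and a fast subsequence converges
  a.e.\<close>

lemma komlos_AE_convergent:
  fixes T :: "nat \<Rightarrow> ('a \<Rightarrow> real) set"
  assumes "sigma_finite_measure N"
    and dec: "\<And>m n. m \<le> n \<Longrightarrow> T n \<subseteq> T m"
    and ne: "\<And>n. T n \<noteq> {}"
    and int0: "\<And>f. f \<in> T 0 \<Longrightarrow> integrable N f"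
    and bd0: "\<And>f. f \<in> T 0 \<Longrightarrow> (\<integral>x. \<bar>f x\<bar> \<partial>N) \<le> B"
    and mid: "\<And>n f g. f \<in> T n \<Longrightarrow> g \<in> T n \<Longrightarrow> (\<lambda>x. (f x + g x) / 2) \<in> T n"
  obtains g where "\<And>k. g k \<in> T k" "AE x in N. convergent (\<lambda>k. g k x)"
proof -
  \<comment> \<open>Positivity of \<open>w\<close> gives strict convexity at every point;
    integrability keeps \<Phi> finite on an infinite measure space, where a positive constant would
    not.\<close>
  obtain w :: "'a \<Rightarrow> real" where wm[measurable]: "w \<in> borel_measurable N"
    and w: "\<And>x. 0 < w x" and wi: "integrable N w"
    using sigma_finite_measure.obtain_positive_integrable_function[OF assms(1)] by metis
  define a where "a = (\<integral>x. w x \<partial>N)"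
  have a: "(\<integral>x. \<bar>w x\<bar> \<partial>N) = a" using w by (simp add: a_def abs_of_pos)
  have a0: "0 \<le> a" unfolding a_def using w by (intro integral_nonneg_AE) (auto simp: less_imp_le)
  have int: "integrable N f" and bd: "(\<integral>x. \<bar>f x\<bar> \<partial>N) \<le> B" if "f \<in> T n" for f n
    using int0 bd0 dec[of 0 n] that by auto
  define \<phi> where "\<phi> f x = sqrt ((w x)\<^sup>2 + (f x)\<^sup>2)" for f x
  define \<Phi> where "\<Phi> f = (\<integral>x. \<phi> f x \<partial>N)" for f
  have \<phi>i: "integrable N (\<phi> f)" and \<Phi>le: "\<Phi> f \<le> a + B" if "f \<in> T n" for f n
    using integrable_sqrt_sum_squares[OF wi int[OF that]] bd[OF that]
    by (auto simp: \<phi>_def[abs_def] \<Phi>_def a)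
  have \<Phi>0: "0 \<le> \<Phi> f" for f unfolding \<Phi>_def \<phi>_def by (intro integral_nonneg_AE) auto
  have B0: "0 \<le> B"
  proof -
    obtain f where "f \<in> T 0" using ne by blast
    have "0 \<le> (\<integral>x. \<bar>f x\<bar> \<partial>N)" by simp
    also have "\<dots> \<le> B" by (rule bd) fact
    finally show ?thesis .
  qed
  define I where "I n = (INF f\<in>T n. \<Phi> f)" for n
  have bb: "bdd_below (\<Phi> ` T n)" for n using \<Phi>0 by (intro bdd_belowI2)
  have I_le: "I n \<le> \<Phi> f" if "f \<in> T n" for n f
    unfolding I_def by (rule cINF_lower[OF bb that])
  have "incseq I"
    unfolding I_def by (intro monoI cINF_superset_mono ne bb dec) auto
  moreover have "I n \<le> a + B" for n
    using ne[of n] I_le \<Phi>le by (meson ex_in_conv order_trans)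
  ultimately obtain L where L: "I \<longlonglongrightarrow> L" "\<And>n. I n \<le> L"
    using incseq_convergent by metis
  have "\<exists>f\<in>T n. \<Phi> f < I n + inverse (Suc n)" for n
    using cINF_less_iff[OF ne bb, of n "I n + inverse (Suc n)"] by (simp add: I_def)
  then obtain f where f: "\<And>n. f n \<in> T n" and f\<Phi>: "\<And>n. \<Phi> (f n) < I n + inverse (Suc n)"
    by metis
  define \<eta> where "\<eta> n = L - I n + inverse (Suc n)" for n
  have \<eta>: "\<eta> \<longlonglongrightarrow> 0"
    unfolding \<eta>_def using tendsto_add[OF tendsto_diff[OF tendsto_const[of L] L(1)] LIMSEQ_inverse_real_of_nat]
    by simp
  have est: "(\<integral>x. min (w x) \<bar>f m x - f n x\<bar> \<partial>N) \<le> e * a + 2 * (a + B) / R + R ^ 3 / e * \<eta> n"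
    and imin: "integrable N (\<lambda>x. min (w x) \<bar>f m x - f n x\<bar>)"
    if nm: "n \<le> m" and e: "0 < e" and R: "0 < R" for m n e R
  proof -
    have fm: "f m \<in> T n" using f dec[OF nm] by auto
    let ?h = "\<lambda>x. (f m x + f n x) / 2"
    have h: "?h \<in> T n" by (rule mid[OF fm f])
    note ii = \<phi>i[OF fm] \<phi>i[OF f[of n]] \<phi>i[OF h]
    note [measurable] = borel_measurable_integrable[OF int[OF f[of n]]] borel_measurable_integrable[OF int[OF fm]]
    show imin: "integrable N (\<lambda>x. min (w x) \<bar>f m x - f n x\<bar>)"
      by (rule Bochner_Integration.integrable_bound[OF wi]) (use w in \<open>auto simp: less_imp_le\<close>)
    let ?S = "\<lambda>x. \<phi> (f m) x + \<phi> (f n) x"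
    have "(\<integral>x. min (w x) \<bar>f m x - f n x\<bar> \<partial>N)
      \<le> (\<integral>x. e * w x + ?S x / R + R ^ 3 / e * (?S x / 2 - \<phi> ?h x) \<partial>N)"
      using imin
    proof (rule integral_mono)
      show "integrable N (\<lambda>x. e * w x + ?S x / R + R ^ 3 / e * (?S x / 2 - \<phi> ?h x))"
        using ii wi by auto
      show "min (w x) \<bar>f m x - f n x\<bar> \<le> e * w x + ?S x / R + R ^ 3 / e * (?S x / 2 - \<phi> ?h x)" for x
        using min_diff_le_sqrt_midpoint_gap[OF w e R] by (simp add: \<phi>_def)
    qed
    also have "\<dots> = e * a + (\<Phi> (f m) + \<Phi> (f n)) / R + R ^ 3 / e * ((\<Phi> (f m) + \<Phi> (f n)) / 2 - \<Phi> ?h)"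
      using ii wi by (simp add: \<Phi>_def a_def)
    also have "\<dots> \<le> e * a + 2 * (a + B) / R + R ^ 3 / e * \<eta> n"
    proof (intro add_mono mult_left_mono divide_right_mono order_refl)
      show "\<Phi> (f m) + \<Phi> (f n) \<le> 2 * (a + B)" using \<Phi>le[OF fm] \<Phi>le[OF f[of n]] by simp
      have "inverse (real (Suc m)) \<le> inverse (Suc n)" using nm by simp
      then show "(\<Phi> (f m) + \<Phi> (f n)) / 2 - \<Phi> ?h \<le> \<eta> n"
        using f\<Phi>[of m] f\<Phi>[of n] I_le[OF h] L(2)[of m] L(2)[of n]
        unfolding \<eta>_def by argo
    qed (use e R in auto)
    finally show "(\<integral>x. min (w x) \<bar>f m x - f n x\<bar> \<partial>N) \<le> e * a + 2 * (a + B) / R + R ^ 3 / e * \<eta> n" .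
  qed
  have ex: "\<exists>n. \<forall>n'\<ge>n. \<forall>m\<ge>n'. (\<integral>x. min (w x) \<bar>f m x - f n' x\<bar> \<partial>N) \<le> d" if d: "0 < d" for d
  proof -
    \<comment> \<open>\<open>e\<close> and \<open>R\<close> make the first two terms of
      \<open>est\<close> at most d/3 each; the added 1 keeps \<open>e\<close> well defined and
      \<open>R\<close> positive when \<open>a\<close> or \<open>a + B\<close> is 0.\<close>
    define e where "e = d / (3 * (a + 1))"
    define R where "R = 6 * (a + B + 1) / d"
    have e: "0 < e" "e * a \<le> d / 3" using d a0 by (auto simp: e_def field_simps)
    have R: "0 < R" "2 * (a + B) / R \<le> d / 3" using d a0 B0 by (auto simp: R_def field_simps)
    have "(\<lambda>n. R ^ 3 / e * \<eta> n) \<longlonglongrightarrow> 0" using tendsto_mult_right_zero[OF \<eta>] by blast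
    then have "\<forall>\<^sub>F n in sequentially. R ^ 3 / e * \<eta> n < d / 3"
      using d by (intro order_tendstoD(2)) auto
    then obtain n where n: "\<And>n'. n' \<ge> n \<Longrightarrow> R ^ 3 / e * \<eta> n' < d / 3"
      unfolding eventually_sequentially by blast
    show ?thesis
    proof (intro exI[of _ n] allI impI)
      fix n' m assume *: "n \<le> n'" "n' \<le> m"
      from est[OF *(2) e(1) R(1)] n[OF *(1)] e R
      show "(\<integral>x. min (w x) \<bar>f m x - f n' x\<bar> \<partial>N) \<le> d" by linarith
    qed
  qed
  have "\<forall>k. \<exists>n. \<forall>n'\<ge>n. \<forall>m\<ge>n'. (\<integral>x. min (w x) \<bar>f m x - f n' x\<bar> \<partial>N) \<le> (1/2) ^ k"
    using ex by simp
  then obtain K where K: "\<And>k n' m. K k \<le> n' \<Longrightarrow> n' \<le> m \<Longrightarrow>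
      (\<integral>x. min (w x) \<bar>f m x - f n' x\<bar> \<partial>N) \<le> (1/2) ^ k"
    by metis
  \<comment> \<open>The partial sums make \<open>r\<close> monotone and at least \<open>K k\<close>;
    the summand k ensures r k \<ge> k, which places \<open>f (r k)\<close> in
    \<open>T k\<close>.\<close>
  define r where "r k = k + (\<Sum>j\<le>k. K j)" for k
  have r: "k \<le> r k" "K k \<le> r k" "r k \<le> r (Suc k)" for k
    using member_le_sum[of k "{..k}" K] by (auto simp: r_def)
  show thesis
  proof (rule that)
    show "f (r k) \<in> T k" for k using f[of "r k"] dec[OF r(1)] by auto
    show "AE x in N. convergent (\<lambda>k. f (r k) x)"
    proof (rule AE_convergent_if_summable_truncated_increments[OF _ wm w])
      show "f (r k) \<in> borel_measurable N" for k using int[OF f] by auto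
      show "(\<integral>\<^sup>+x. ennreal (min (w x) \<bar>f (r (Suc k)) x - f (r k) x\<bar>) \<partial>N) \<le> ennreal ((1/2) ^ k)" for k
        using K[OF r(2,3), of k] w
        by (subst nn_integral_eq_integral[OF imin[OF r(3), of 1 1]]) (auto simp: less_imp_le intro!: ennreal_leI)
    qed
  qed
qed

section \<open>Passing to the limit under the integral: Fatou and Vitali\<close>

lemma fatou_integrable:
  fixes h :: "nat \<Rightarrow> 'a \<Rightarrow> real"
  assumes i: "\<And>k. integrable N (h k)" and nn: "\<And>k x. 0 \<le> h k x" "\<And>x. 0 \<le> H x"
    and [measurable]: "H \<in> borel_measurable N"
    and lim: "AE x in N. (\<lambda>k. h k x) \<longlonglongrightarrow> H x"
    and B: "\<And>k. (\<integral>x. h k x \<partial>N) \<le> B"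
  shows "integrable N H" "(\<integral>x. H x \<partial>N) \<le> B"
proof -
  note [measurable] = borel_measurable_integrable[OF i]
  have B0: "0 \<le> B" using B[of 0] nn(1) by (meson Bochner_Integration.integral_nonneg order_trans)
  have "(\<integral>\<^sup>+x. ennreal (H x) \<partial>N) = (\<integral>\<^sup>+x. liminf (\<lambda>k. ennreal (h k x)) \<partial>N)"
  proof (rule nn_integral_cong_AE)
    show "AE x in N. ennreal (H x) = liminf (\<lambda>k. ennreal (h k x))"
      using lim by eventually_elim (metis lim_imp_Liminf sequentially_bot tendsto_ennrealI)
  qed
  also have "\<dots> \<le> liminf (\<lambda>k. \<integral>\<^sup>+x. ennreal (h k x) \<partial>N)"
    by (rule nn_integral_liminf) measurable
  also have "\<dots> \<le> ennreal B"
  proof (rule Liminf_le)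
    show "\<forall>\<^sub>F k in sequentially. (\<integral>\<^sup>+x. ennreal (h k x) \<partial>N) \<le> ennreal B"
      using B by (intro always_eventually allI)
        (auto simp: nn_integral_eq_integral[OF i] nn intro!: ennreal_leI)
  qed simp
  finally have *: "(\<integral>\<^sup>+x. ennreal (H x) \<partial>N) \<le> ennreal B" .
  show "integrable N H"
    using * nn(2) by (intro integrableI_nonneg) (auto simp: ennreal_less_top intro: le_less_trans)
  then show "(\<integral>x. H x \<partial>N) \<le> B"
    using * B0 nn(2) by (simp add: nn_integral_eq_integral)
qed

lemma abs_set_integral_le:
  fixes f :: "'a \<Rightarrow> real"
  assumes "integrable N f" "E \<in> sets N"
  shows "\<bar>set_lebesgue_integral N E f\<bar> \<le> (\<integral>x. \<bar>f x\<bar> \<partial>N)"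
proof -
  have "\<bar>set_lebesgue_integral N E f\<bar> \<le> (\<integral>x. \<bar>indicator E x *\<^sub>R f x\<bar> \<partial>N)"
    unfolding set_lebesgue_integral_def by (rule integral_abs_bound)
  also have "\<dots> \<le> (\<integral>x. \<bar>f x\<bar> \<partial>N)"
    using integrable_mult_indicator[OF assms(2,1)] assms(1)
    by (intro integral_mono) (auto simp: indicator_def)
  finally show ?thesis .
qed

lemma integrable_excess:
  fixes f :: "'a \<Rightarrow> real"
  assumes "integrable N f" "0 \<le> K"
  shows "integrable N (\<lambda>x. max 0 (\<bar>f x\<bar> - K))"
  by (rule Bochner_Integration.integrable_bound[OF assms(1)]) (use assms in auto)

text \<open>\<open>c\<close> clips values to [-K, K]. Clipping changes an integral over
  \<open>E\<close> by at most the integral of the excess (|f| - K)^+, which is small uniformly in k,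
  while the clipped functions are dominated on \<open>E\<close> by the constant \<open>K\<close>,
  integrable because \<open>E\<close> has finite measure.\<close>

lemma vitali_set_integral_tendsto:
  fixes g :: "nat \<Rightarrow> 'a \<Rightarrow> real"
  assumes gi: "\<And>k. integrable N (g k)" and Vi: "integrable N V"
    and lim: "AE x in N. (\<lambda>k. g k x) \<longlonglongrightarrow> V x"
    and E[measurable]: "E \<in> sets N" and fin: "emeasure N E < \<infinity>"
    and ui: "\<And>e. 0 < e \<Longrightarrow> \<exists>K\<ge>0. (\<forall>k. (\<integral>x. max 0 (\<bar>g k x\<bar> - K) \<partial>N) \<le> e)
               \<and> (\<integral>x. max 0 (\<bar>V x\<bar> - K) \<partial>N) \<le> e"
  shows "(\<lambda>k. set_lebesgue_integral N E (g k)) \<longlonglongrightarrow> set_lebesgue_integral N E V"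
proof (rule LIMSEQ_I)
  fix e :: real assume e: "0 < e"
  note [measurable] = borel_measurable_integrable[OF gi] borel_measurable_integrable[OF Vi]
  obtain K where K: "0 \<le> K" "\<And>k. (\<integral>x. max 0 (\<bar>g k x\<bar> - K) \<partial>N) \<le> e / 3"
      "(\<integral>x. max 0 (\<bar>V x\<bar> - K) \<partial>N) \<le> e / 3"
    using ui[of "e / 3"] e by auto
  define c where "c x = max (- K) (min K x)" for x :: real
  have c_le: "\<bar>c x\<bar> \<le> K" "\<bar>c x\<bar> \<le> \<bar>x\<bar>" and c_diff: "\<bar>x - c x\<bar> = max 0 (\<bar>x\<bar> - K)" for x
    using K(1) by (auto simp: c_def max_def min_def)
  have c_cont: "continuous_on UNIV c" unfolding c_def by (intro continuous_intros)
  have [measurable]: "c \<in> borel_measurable borel" using c_cont by (rule borel_measurable_continuous_onI)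
  have ci: "integrable N (\<lambda>x. c (f x))" if "integrable N f" for f
    by (rule Bochner_Integration.integrable_bound[OF that])
       (use borel_measurable_integrable[OF that] c_le in auto)
  have trunc: "\<bar>set_lebesgue_integral N E f - set_lebesgue_integral N E (\<lambda>x. c (f x))\<bar>
      \<le> (\<integral>x. max 0 (\<bar>f x\<bar> - K) \<partial>N)" if f: "integrable N f" for f
  proof -
    have "set_lebesgue_integral N E f - set_lebesgue_integral N E (\<lambda>x. c (f x))
      = set_lebesgue_integral N E (\<lambda>x. f x - c (f x))"
      using integrable_mult_indicator[OF E f] integrable_mult_indicator[OF E ci[OF f]]
      by (subst set_integral_diff) (auto simp: set_integrable_def)
    then show ?thesis
      using abs_set_integral_le[OF Bochner_Integration.integrable_diff[OF f ci[OF f]] E]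
      by (simp add: c_diff)
  qed
  have "(\<lambda>k. set_lebesgue_integral N E (\<lambda>x. c (g k x))) \<longlonglongrightarrow> set_lebesgue_integral N E (\<lambda>x. c (V x))"
    unfolding set_lebesgue_integral_def
  proof (rule integral_dominated_convergence[where w = "\<lambda>x. indicator E x * K"])
    show "integrable N (\<lambda>x. indicator E x * K)"
      using fin by (intro integrable_mult_left) auto
    show "AE x in N. (\<lambda>k. indicator E x *\<^sub>R c (g k x)) \<longlonglongrightarrow> indicator E x *\<^sub>R c (V x)"
      using lim by eventually_elim
        (intro tendsto_intros continuous_on_tendsto_compose[OF c_cont], auto)
    show "AE x in N. norm (indicator E x *\<^sub>R c (g k x)) \<le> indicator E x * K" for k
      using c_le(1) by (auto simp: indicator_def)
  qed measurable
  then obtain n where n: "\<And>k. k \<ge> n \<Longrightarrow> \<bar>set_lebesgue_integral N E (\<lambda>x. c (g k x))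
      - set_lebesgue_integral N E (\<lambda>x. c (V x))\<bar> < e / 3"
    using LIMSEQ_D[of _ _ "e / 3"] e by (metis divide_pos_pos real_norm_def zero_less_numeral)
  show "\<exists>n. \<forall>k\<ge>n. norm (set_lebesgue_integral N E (g k) - set_lebesgue_integral N E V) < e"
  proof (intro exI[of _ n] allI impI)
    fix k assume "n \<le> k"
    from n[OF this] trunc[OF gi[of k]] trunc[OF Vi] K(2)[of k] K(3)
    show "norm (set_lebesgue_integral N E (g k) - set_lebesgue_integral N E V) < e"
      unfolding real_norm_def by linarith
  qed
qed

section \<open>Cut-norm limits in closed midpoint-convex sets\<close>

lemma cut_norm_le_iff:
  "cut_norm M F \<le> ennreal e \<longleftrightarrow> (\<forall>T\<in>sets M. \<forall>U\<in>sets M.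
     ennreal \<bar>set_lebesgue_integral (M \<Otimes>\<^sub>M M) (T \<times> U) F\<bar> \<le> ennreal e)"
  unfolding cut_norm_def by (auto simp: SUP_le_iff)

text \<open>The common core of all three parts. The Komlos lemma, applied to the sets \<T> n, gives
  functions \<open>g k\<close> with an a.e. limit \<open>V\<close>. Rectangle integrals of
  \<open>g k\<close> inherit every interval that contains those of the tail of \<open>Ws\<close>,
  and on rectangles with sides of finite measure they converge to those of \<open>V\<close>.\<close>

lemma cut_converges_in_midpoint_convex_closed:
  fixes M :: "'a measure" and A :: "('a \<times> 'a \<Rightarrow> real) set"
  assumes M: "sigma_finite_measure M"
    and int: "\<And>f. f \<in> A \<Longrightarrow> integrable (M \<Otimes>\<^sub>M M) f"
    and bd: "\<And>f. f \<in> A \<Longrightarrow> (\<integral>z. \<bar>f z\<bar> \<partial>(M \<Otimes>\<^sub>M M)) \<le> B"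
    and ui: "\<And>e. 0 < e \<Longrightarrow> \<exists>K\<ge>0. \<forall>f\<in>A. (\<integral>z. max 0 (\<bar>f z\<bar> - K) \<partial>(M \<Otimes>\<^sub>M M)) \<le> e"
    and mid: "\<And>f g. f \<in> A \<Longrightarrow> g \<in> A \<Longrightarrow> (\<lambda>z. (f z + g z) / 2) \<in> A"
    and closed: "\<And>g V. (\<And>k. g k \<in> A) \<Longrightarrow> V \<in> borel_measurable (M \<Otimes>\<^sub>M M) \<Longrightarrow>
        AE z in M \<Otimes>\<^sub>M M. (\<lambda>k. g k z) \<longlonglongrightarrow> V z \<Longrightarrow> V \<in> A"
    and Ws: "\<And>n. Ws n \<in> A" and cauchy: "cut_Cauchy M Ws"
  shows "\<exists>V\<in>A. cut_converges M Ws V"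
proof -
  interpret M: sigma_finite_measure M by fact
  interpret MM: pair_sigma_finite M M ..
  let ?N = "M \<Otimes>\<^sub>M M"
  let ?I = "\<lambda>T U f. set_lebesgue_integral ?N (T \<times> U) f"
  have si: "set_integrable ?N (T \<times> U) f" if "f \<in> A" "T \<in> sets M" "U \<in> sets M" for f T U
    unfolding set_integrable_def using that by (intro integrable_mult_indicator int) auto
  \<comment> \<open>A stand-in for the closed convex hull of the tail of \<open>Ws\<close>, tested on rectangles only.\<close>
  define \<T> where "\<T> n = {f \<in> A. \<forall>T\<in>sets M. \<forall>U\<in>sets M. \<forall>a b.
      (\<forall>m\<ge>n. a \<le> ?I T U (Ws m) \<and> ?I T U (Ws m) \<le> b) \<longrightarrow> a \<le> ?I T U f \<and> ?I T U f \<le> b}" for n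
  obtain g where g: "\<And>k. g k \<in> \<T> k" and conv: "AE z in ?N. convergent (\<lambda>k. g k z)"
  proof (rule komlos_AE_convergent[of ?N \<T> B])
    show "sigma_finite_measure ?N" by unfold_locales
    show "\<T> n \<subseteq> \<T> m" if "m \<le> n" for m n
    proof
      fix f assume f: "f \<in> \<T> n"
      show "f \<in> \<T> m"
        unfolding \<T>_def
      proof (intro CollectI conjI ballI allI impI)
        show "f \<in> A" using f by (simp add: \<T>_def)
        fix T U a b assume "T \<in> sets M" "U \<in> sets M"
          and *: "\<forall>k\<ge>m. a \<le> ?I T U (Ws k) \<and> ?I T U (Ws k) \<le> b"
        moreover have "\<forall>k\<ge>n. a \<le> ?I T U (Ws k) \<and> ?I T U (Ws k) \<le> b" using * that by auto
        ultimately show "a \<le> ?I T U f" "?I T U f \<le> b" using f unfolding \<T>_def by blast+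
      qed
    qed
    show "\<T> n \<noteq> {}" for n
    proof -
      have "Ws n \<in> \<T> n" using Ws unfolding \<T>_def by blast
      then show ?thesis by blast
    qed
    show "integrable ?N f" "(\<integral>z. \<bar>f z\<bar> \<partial>?N) \<le> B" if "f \<in> \<T> 0" for f
      using that int bd by (auto simp: \<T>_def)
    show "(\<lambda>z. (f z + h z) / 2) \<in> \<T> n" if f: "f \<in> \<T> n" and h: "h \<in> \<T> n" for n f h
      unfolding \<T>_def
    proof (intro CollectI conjI ballI allI impI)
      have fh: "f \<in> A" "h \<in> A" using f h by (auto simp: \<T>_def)
      show "(\<lambda>z. (f z + h z) / 2) \<in> A" using fh by (rule mid)
      fix T U a b assume TU: "T \<in> sets M" "U \<in> sets M"
        and *: "\<forall>m\<ge>n. a \<le> ?I T U (Ws m) \<and> ?I T U (Ws m) \<le> b"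
      have "?I T U (\<lambda>z. (f z + h z) / 2) = (?I T U f + ?I T U h) / 2"
        using si[OF fh(1) TU] si[OF fh(2) TU] by simp
      moreover have "a \<le> ?I T U f \<and> ?I T U f \<le> b" "a \<le> ?I T U h \<and> ?I T U h \<le> b"
        using f h TU * unfolding \<T>_def by blast+
      ultimately show "a \<le> ?I T U (\<lambda>z. (f z + h z) / 2)" "?I T U (\<lambda>z. (f z + h z) / 2) \<le> b"
        by auto
    qed
  qed blast
  have gA: "g k \<in> A" for k using g[of k] by (simp add: \<T>_def)
  note [measurable] = borel_measurable_integrable[OF int[OF gA]]
  \<comment> \<open>Where the sequence diverges, a null set, \<open>lim\<close> returns an arbitrary
    default value; \<open>V\<close> is still measurable.\<close>
  define V where "V z = lim (\<lambda>k. g k z)" for z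
  have Vm: "V \<in> borel_measurable ?N" unfolding V_def[abs_def] by measurable
  have gV: "AE z in ?N. (\<lambda>k. g k z) \<longlonglongrightarrow> V z"
    using conv by eventually_elim (simp add: V_def convergent_LIMSEQ_iff)
  have VA: "V \<in> A" by (rule closed[OF gA Vm gV])
  have lim: "(\<lambda>k. ?I T U (g k)) \<longlonglongrightarrow> ?I T U V"
    if "T \<in> sets M" "U \<in> sets M" "emeasure M T < \<infinity>" "emeasure M U < \<infinity>" for T U
  proof (rule vitali_set_integral_tendsto[OF int[OF gA] int[OF VA] gV])
    show "T \<times> U \<in> sets ?N" using that by auto
    show "emeasure ?N (T \<times> U) < \<infinity>"
      using that by (simp add: M.emeasure_pair_measure_Times ennreal_mult_less_top)
    show "\<exists>K\<ge>0. (\<forall>k. (\<integral>z. max 0 (\<bar>g k z\<bar> - K) \<partial>?N) \<le> e) \<and> (\<integral>z. max 0 (\<bar>V z\<bar> - K) \<partial>?N) \<le> e"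
      if "0 < e" for e
      using ui[OF that] gA VA by blast
  qed
  obtain S where S: "range S \<subseteq> sets M" "(\<Union>i. S i) = space M" "\<And>i. emeasure M (S i) \<noteq> \<infinity>" "incseq S"
    using M.sigma_finite_incseq by blast
  have bound: "\<exists>n. \<forall>m\<ge>n. cut_norm M (\<lambda>z. Ws m z - V z) \<le> ennreal e" if e: "0 < e" for e :: real
  proof -
    obtain n where n: "\<And>m k. m \<ge> n \<Longrightarrow> k \<ge> n \<Longrightarrow> cut_norm M (\<lambda>z. Ws m z - Ws k z) < ennreal e"
      using cauchy e unfolding cut_Cauchy_def by blast
    have near: "\<bar>?I T U (Ws m) - ?I T U (Ws k)\<bar> \<le> e"
      if "m \<ge> n" "k \<ge> n" and TU: "T \<in> sets M" "U \<in> sets M" for m k T U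
      using n[OF that(1,2), THEN less_imp_le] TU e
      by (simp add: cut_norm_le_iff flip: set_integral_diff(2)[OF si[OF Ws TU] si[OF Ws TU]])
    have nearV: "\<bar>?I T U (Ws m) - ?I T U V\<bar> \<le> e"
      if m: "m \<ge> n" and TU: "T \<in> sets M" "U \<in> sets M" "emeasure M T < \<infinity>" "emeasure M U < \<infinity>" for m T U
    proof (rule LIMSEQ_le_const2)
      show "(\<lambda>k. \<bar>?I T U (Ws m) - ?I T U (g k)\<bar>) \<longlonglongrightarrow> \<bar>?I T U (Ws m) - ?I T U V\<bar>"
        by (intro tendsto_intros lim TU)
      have "\<bar>?I T U (Ws m) - ?I T U (g k)\<bar> \<le> e" if k: "k \<ge> n" for k
      proof -
        \<comment> \<open>The interval of radius \<open>e\<close> about the integral of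
          \<open>Ws m\<close> contains those of all \<open>Ws j\<close> with j \<ge> k, so the
          definition of \<T> k puts that of \<open>g k\<close> in it too.\<close>
        let ?a = "?I T U (Ws m) - e" and ?b = "?I T U (Ws m) + e"
        have "\<forall>j\<ge>k. ?a \<le> ?I T U (Ws j) \<and> ?I T U (Ws j) \<le> ?b"
        proof (intro allI impI)
          fix j assume "j \<ge> k"
          then show "?a \<le> ?I T U (Ws j) \<and> ?I T U (Ws j) \<le> ?b"
            using near[OF m _ TU(1,2), of j] k by simp linarith
        qed
        then have "?a \<le> ?I T U (g k) \<and> ?I T U (g k) \<le> ?b"
          using g[of k] TU(1,2) unfolding \<T>_def by blast
        then show ?thesis by linarith
      qed
      then show "\<exists>j. \<forall>k\<ge>j. \<bar>?I T U (Ws m) - ?I T U (g k)\<bar> \<le> e" by blast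
    qed
    show ?thesis
    proof (intro exI[of _ n] allI impI, unfold cut_norm_le_iff, intro ballI)
      fix m T U assume m: "n \<le> m" and TU: "T \<in> sets M" "U \<in> sets M"
      \<comment> \<open>A general rectangle is exhausted by rectangles with sides of finite measure.
        The two coordinates of a point may enter \<open>S\<close> at different stages, hence the
        larger index in the proof of \<open>un\<close>.\<close>
      let ?T = "\<lambda>i. T \<inter> S i" and ?U = "\<lambda>i. U \<inter> S i"
      have TUi: "?T i \<in> sets M" "?U i \<in> sets M" for i using S(1) TU by auto
      have fin: "emeasure M (?T i) < \<infinity>" "emeasure M (?U i) < \<infinity>" for i
        using S(1,3) emeasure_mono[of "?T i" "S i" M] emeasure_mono[of "?U i" "S i" M]
        by (auto simp: less_top range_subsetD intro: le_less_trans)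
      have un: "(\<Union>i. ?T i \<times> ?U i) = T \<times> U"
      proof (intro equalityI subsetI)
        fix z assume z: "z \<in> T \<times> U"
        then have "fst z \<in> (\<Union>i. S i)" "snd z \<in> (\<Union>i. S i)"
          using TU[THEN sets.sets_into_space] by (auto simp: S(2))
        then obtain i j where "fst z \<in> S i" "snd z \<in> S j" by blast
        then have "fst z \<in> S (max i j)" "snd z \<in> S (max i j)"
          using incseqD[OF S(4), of i "max i j"] incseqD[OF S(4), of j "max i j"] by auto
        with z show "z \<in> (\<Union>i. ?T i \<times> ?U i)" by force
      qed auto
      have inc: "incseq (\<lambda>i. ?T i \<times> ?U i)" using S(4) unfolding incseq_def by blast
      have cont: "(\<lambda>i. ?I (?T i) (?U i) f) \<longlonglongrightarrow> ?I T U f" if "f \<in> A" for f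
        using set_integral_cont_up[of "\<lambda>i. ?T i \<times> ?U i" ?N f] TUi inc si[OF that TU] un by auto
      have "\<bar>?I T U (Ws m) - ?I T U V\<bar> \<le> e"
      proof (rule LIMSEQ_le_const2)
        show "(\<lambda>i. \<bar>?I (?T i) (?U i) (Ws m) - ?I (?T i) (?U i) V\<bar>) \<longlonglongrightarrow> \<bar>?I T U (Ws m) - ?I T U V\<bar>"
          by (intro tendsto_intros cont Ws VA)
        show "\<exists>j. \<forall>i\<ge>j. \<bar>?I (?T i) (?U i) (Ws m) - ?I (?T i) (?U i) V\<bar> \<le> e"
          using nearV[OF m TUi fin] by blast
      qed
      then show "ennreal \<bar>?I T U (\<lambda>z. Ws m z - V z)\<bar> \<le> ennreal e"
        using set_integral_diff(2)[OF si[OF Ws TU] si[OF VA TU]] by (simp add: ennreal_leI)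
    qed
  qed
  have "cut_converges M Ws V"
    unfolding cut_converges_def
  proof (rule tendsto_zero_ennreal)
    fix e :: real assume e: "0 < e"
    with bound[of "e / 2"] obtain n where "\<And>m. m \<ge> n \<Longrightarrow> cut_norm M (\<lambda>z. Ws m z - V z) \<le> ennreal (e / 2)"
      by auto
    moreover have "ennreal (e / 2) < ennreal e" using e by (simp add: ennreal_less_iff)
    ultimately show "\<forall>\<^sub>F m in sequentially. cut_norm M (\<lambda>z. Ws m z - V z) < ennreal e"
      unfolding eventually_sequentially by (meson le_less_trans)
  qed
  with VA show ?thesis by blast
qed

section \<open>Bounds in L^p: uniform integrability, midpoints, limits\<close>

text \<open>Integrability is stated separately because the Bochner integral of a non-integrable
  function defaults to 0 and would satisfy any nonnegative bound.\<close>

lemma Lp_le_powr_iff: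
  assumes [measurable]: "f \<in> borel_measurable N" and p: "p \<noteq> \<infinity>"
  shows "Lp_le N p f C \<longleftrightarrow> 0 \<le> C \<and> integrable N (\<lambda>x. \<bar>f x\<bar> powr enn2real p)
    \<and> (\<integral>x. \<bar>f x\<bar> powr enn2real p \<partial>N) \<le> C powr enn2real p"
proof (cases "integrable N (\<lambda>x. \<bar>f x\<bar> powr enn2real p)")
  case True
  then show ?thesis
    using p by (simp add: Lp_le_def nn_integral_eq_integral)
next
  case False
  have "\<not> (\<integral>\<^sup>+x. ennreal (\<bar>f x\<bar> powr enn2real p) \<partial>N) \<le> ennreal (C powr enn2real p)"
  proof
    assume "(\<integral>\<^sup>+x. ennreal (\<bar>f x\<bar> powr enn2real p) \<partial>N) \<le> ennreal (C powr enn2real p)"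
    also have "\<dots> < \<infinity>" by simp
    finally have "integrable N (\<lambda>x. \<bar>f x\<bar> powr enn2real p)"
      by (intro integrableI_nonneg) auto
    with False show False by contradiction
  qed
  then show ?thesis
    using p False by (simp add: Lp_le_def)
qed

text \<open>For |x| > K, write |x| = |x|^(1-q) |x|^q; the exponent 1 - q is negative, so |x|^(1-q)
  \<le> K^(1-q).\<close>

lemma excess_le_powr:
  fixes x K q :: real
  assumes "0 < K" "1 < q"
  shows "max 0 (\<bar>x\<bar> - K) \<le> K powr (1 - q) * \<bar>x\<bar> powr q"
proof (cases "\<bar>x\<bar> \<le> K")
  case False
  then have "\<bar>x\<bar> = \<bar>x\<bar> powr (1 - q) * \<bar>x\<bar> powr q"
    using assms by (simp flip: powr_add)
  also have "\<dots> \<le> K powr (1 - q) * \<bar>x\<bar> powr q"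
    using False assms by (intro mult_right_mono powr_mono2') auto
  finally show ?thesis using assms by simp
qed auto

lemma enn2real_gt_1:
  assumes "1 < p" "p \<noteq> \<infinity>"
  shows "1 < enn2real p"
  using assms by (cases p) auto

text \<open>The threshold \<open>K\<close> is chosen before \<open>f\<close>, so one value serves
  the whole L^p ball. For finite p the excess integral is at most K^(1-p) C^p, which tends to 0 as K
  grows; for infinite p it vanishes once K \<ge> C.\<close>

lemma Lp_le_uniformly_integrable:
  assumes p: "1 < p" and e: "0 < e"
  shows "\<exists>K\<ge>0. \<forall>f. integrable N f \<longrightarrow> Lp_le N p f C \<longrightarrow> (\<integral>x. max 0 (\<bar>f x\<bar> - K) \<partial>N) \<le> e"
proof (cases "p = \<infinity>")
  case True
  show ?thesis
  \<comment> \<open>The sign of \<open>C\<close> is known only once some \<open>f\<close> satisfies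
    the bound, but the threshold must be nonnegative beforehand; hence
    \<open>max 0 C\<close>.\<close>
  proof (intro exI[of _ "max 0 C"] conjI allI impI)
    fix f assume "Lp_le N p f C"
    then have "AE x in N. max 0 (\<bar>f x\<bar> - max 0 C) = 0"
      using True by (auto simp: Lp_le_def)
    then have "(\<integral>x. max 0 (\<bar>f x\<bar> - max 0 C) \<partial>N) = 0"
      by (rule integral_eq_zero_AE)
    then show "(\<integral>x. max 0 (\<bar>f x\<bar> - max 0 C) \<partial>N) \<le> e" using e by simp
  qed simp
next
  case False
  define q where "q = enn2real p"
  have q: "1 < q" unfolding q_def using p False by (rule enn2real_gt_1)
  have "((\<lambda>K. K powr (1 - q)) \<longlongrightarrow> 0) at_top"
    using q by (intro tendsto_neg_powr filterlim_ident) auto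
  then have "((\<lambda>K. K powr (1 - q) * C powr q) \<longlongrightarrow> 0) at_top"
    by (rule tendsto_mult_left_zero)
  then have "\<forall>\<^sub>F K in at_top. K powr (1 - q) * C powr q < e"
    using e by (rule order_tendstoD(2))
  then obtain K where K: "0 < K" "K powr (1 - q) * C powr q < e"
    using eventually_happens'[OF _ eventually_conj[OF eventually_gt_at_top[of "0::real"]]] by force
  show ?thesis
  proof (intro exI[of _ K] conjI allI impI)
    fix f assume f: "integrable N f" "Lp_le N p f C"
    then have L: "integrable N (\<lambda>x. \<bar>f x\<bar> powr q)" "(\<integral>x. \<bar>f x\<bar> powr q \<partial>N) \<le> C powr q"
      using Lp_le_powr_iff[OF borel_measurable_integrable[OF f(1)] False] by (auto simp: q_def)
    have "(\<integral>x. max 0 (\<bar>f x\<bar> - K) \<partial>N) \<le> (\<integral>x. K powr (1 - q) * \<bar>f x\<bar> powr q \<partial>N)"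
      using f(1) L(1) K(1) q
      by (intro integral_mono integrable_excess excess_le_powr) auto
    also have "\<dots> \<le> K powr (1 - q) * C powr q" using L(2) by (simp add: mult_left_mono)
    finally show "(\<integral>x. max 0 (\<bar>f x\<bar> - K) \<partial>N) \<le> e" using K(2) by simp
  qed (use K in auto)
qed

lemma powr_abs_midpoint_le:
  fixes a b q :: real
  assumes q: "1 < q"
  shows "\<bar>(a + b) / 2\<bar> powr q \<le> (\<bar>a\<bar> powr q + \<bar>b\<bar> powr q) / 2"
proof -
  have half: "(x / 2) powr q \<le> x powr q / 2" if "0 \<le> x" for x :: real
  proof -
    have "(1 / 2 :: real) powr q \<le> (1 / 2) powr 1" using q by (intro powr_mono') auto
    then have "x powr q * (1 / 2) powr q \<le> x powr q * (1 / 2)"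
      by (intro mult_left_mono) auto
    then show ?thesis using that powr_mult[of x "1 / 2" q] by simp
  qed
  have "\<bar>(a + b) / 2\<bar> powr q \<le> ((\<bar>a\<bar> + \<bar>b\<bar>) / 2) powr q"
    using q by (intro powr_mono2) auto
  also have "\<dots> \<le> (\<bar>a\<bar> powr q + \<bar>b\<bar> powr q) / 2"
  \<comment> \<open>Convexity of the power is used for positive arguments only; \<open>half\<close>
    covers a vanishing a or b.\<close>
  proof (cases "a = 0 \<or> b = 0")
    case True
    then show ?thesis using half[of "\<bar>a\<bar>"] half[of "\<bar>b\<bar>"] q by auto
  next
    case False
    then show ?thesis
      using convex_onD[OF powr_convex[of q], of "1 / 2" "\<bar>a\<bar>" "\<bar>b\<bar>"] q
      by (simp add: add_divide_distrib)
  qed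
  finally show ?thesis .
qed

lemma Lp_le_midpoint:
  assumes [measurable]: "f \<in> borel_measurable N" "g \<in> borel_measurable N"
    and p: "1 < p" and f: "Lp_le N p f C" and g: "Lp_le N p g C"
  shows "Lp_le N p (\<lambda>x. (f x + g x) / 2) C"
proof (cases "p = \<infinity>")
  case True
  then have "AE x in N. \<bar>f x\<bar> \<le> C" "AE x in N. \<bar>g x\<bar> \<le> C"
    using f g by (auto simp: Lp_le_def)
  then have "AE x in N. \<bar>(f x + g x) / 2\<bar> \<le> C" by eventually_elim auto
  then show ?thesis using f True by (simp add: Lp_le_def)
next
  case False
  define q where "q = enn2real p"
  have q: "1 < q" unfolding q_def using p False by (rule enn2real_gt_1)
  have L: "0 \<le> C" "integrable N (\<lambda>x. \<bar>f x\<bar> powr q)" "(\<integral>x. \<bar>f x\<bar> powr q \<partial>N) \<le> C powr q"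
    "integrable N (\<lambda>x. \<bar>g x\<bar> powr q)" "(\<integral>x. \<bar>g x\<bar> powr q \<partial>N) \<le> C powr q"
    using f g by (auto simp: Lp_le_powr_iff[OF _ False] q_def)
  have i: "integrable N (\<lambda>x. (\<bar>f x\<bar> powr q + \<bar>g x\<bar> powr q) / 2)" using L by auto
  have i': "integrable N (\<lambda>x. \<bar>(f x + g x) / 2\<bar> powr q)"
    by (rule Bochner_Integration.integrable_bound[OF i])
       (use powr_abs_midpoint_le[OF q] in auto)
  have "(\<integral>x. \<bar>(f x + g x) / 2\<bar> powr q \<partial>N) \<le> (\<integral>x. (\<bar>f x\<bar> powr q + \<bar>g x\<bar> powr q) / 2 \<partial>N)"
    using i' i by (rule integral_mono) (rule powr_abs_midpoint_le[OF q])
  also have "\<dots> \<le> C powr q" using L by simp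
  finally show ?thesis using i' L(1) by (simp add: Lp_le_powr_iff[OF _ False] q_def)
qed

text \<open>For infinite p the countably many exceptional null sets are merged and the bound passes
  to the limit pointwise; for finite p this is Fatou's lemma for |g k|^p.\<close>

lemma Lp_le_AE_limit:
  fixes g :: "nat \<Rightarrow> 'a \<Rightarrow> real"
  assumes [measurable]: "\<And>k. g k \<in> borel_measurable N" "V \<in> borel_measurable N"
    and p: "1 < p" and g: "\<And>k. Lp_le N p (g k) C"
    and lim: "AE x in N. (\<lambda>k. g k x) \<longlonglongrightarrow> V x"
  shows "Lp_le N p V C"
proof (cases "p = \<infinity>")
  case True
  then have "AE x in N. \<forall>k. \<bar>g k x\<bar> \<le> C"
    using g by (auto simp: Lp_le_def AE_all_countable)
  with lim have "AE x in N. \<bar>V x\<bar> \<le> C"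
  proof eventually_elim
    case (elim x)
    then show ?case by (intro LIMSEQ_le_const2[OF tendsto_rabs]) auto
  qed
  then show ?thesis using g[of 0] True by (simp add: Lp_le_def)
next
  case False
  define q where "q = enn2real p"
  have q: "1 < q" unfolding q_def using p False by (rule enn2real_gt_1)
  have L: "0 \<le> C" "integrable N (\<lambda>x. \<bar>g k x\<bar> powr q)" "(\<integral>x. \<bar>g k x\<bar> powr q \<partial>N) \<le> C powr q" for k
    using g[of k] by (auto simp: Lp_le_powr_iff[OF _ False] q_def)
  have "AE x in N. (\<lambda>k. \<bar>g k x\<bar> powr q) \<longlonglongrightarrow> \<bar>V x\<bar> powr q"
    using lim
  proof eventually_elim
    case (elim x)
    then show ?case using q by (intro tendsto_powr' tendsto_rabs tendsto_const) auto
  qed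
  from fatou_integrable[OF L(2) _ _ _ this L(3)] L(1) show ?thesis
    by (simp add: Lp_le_powr_iff[OF _ False] q_def)
qed

section \<open>Symmetry, and limits of graphons\<close>

text \<open>The coordinate swap preserves the product measure, so preimages of null sets are
  null.\<close>

lemma AE_pair_swap:
  assumes "sigma_finite_measure M" and P: "AE z in M \<Otimes>\<^sub>M M. P z"
  shows "AE z in M \<Otimes>\<^sub>M M. P (snd z, fst z)"
proof -
  interpret M: sigma_finite_measure M by fact
  interpret MM: pair_sigma_finite M M ..
  have "AE z in distr (M \<Otimes>\<^sub>M M) (M \<Otimes>\<^sub>M M) (\<lambda>(x, y). (y, x)). P z"
    using P MM.distr_pair_swap by metis
  from AE_distrD[OF measurable_pair_swap' this] show ?thesis
    by (simp add: case_prod_beta)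
qed

lemma graphon_AE_limit:
  assumes M: "sigma_finite_measure M" and g: "\<And>k. graphon M (g k)"
    and [measurable]: "V \<in> borel_measurable (M \<Otimes>\<^sub>M M)"
    and lim: "AE z in M \<Otimes>\<^sub>M M. (\<lambda>k. g k z) \<longlonglongrightarrow> V z"
    and B: "\<And>k. (\<integral>z. \<bar>g k z\<bar> \<partial>(M \<Otimes>\<^sub>M M)) \<le> B"
  shows "graphon M V" "(\<integral>z. \<bar>V z\<bar> \<partial>(M \<Otimes>\<^sub>M M)) \<le> B"
proof -
  let ?N = "M \<Otimes>\<^sub>M M"
  have "integrable ?N (\<lambda>z. \<bar>g k z\<bar>)" for k using g by (simp add: graphon_def)
  moreover have "AE z in ?N. (\<lambda>k. \<bar>g k z\<bar>) \<longlonglongrightarrow> \<bar>V z\<bar>"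
    using lim by eventually_elim (rule tendsto_rabs)
  ultimately have V: "integrable ?N (\<lambda>z. \<bar>V z\<bar>)" "(\<integral>z. \<bar>V z\<bar> \<partial>?N) \<le> B"
    using fatou_integrable[of ?N "\<lambda>k z. \<bar>g k z\<bar>" "\<lambda>z. \<bar>V z\<bar>" B] B by auto
  then show "(\<integral>z. \<bar>V z\<bar> \<partial>?N) \<le> B" by simp
  have "AE z in ?N. \<forall>k. g k z = g k (snd z, fst z)"
    using g by (auto simp: graphon_def AE_all_countable)
  \<comment> \<open>Convergence is needed at z and at its mirror image; symmetry of each
    \<open>g k\<close> makes the two sequences equal, and limits are unique.\<close>
  with lim AE_pair_swap[OF M lim] have "AE z in ?N. V z = V (snd z, fst z)"
  proof eventually_elim
    case (elim z)
    then show ?case by (auto intro: LIMSEQ_unique)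
  qed
  moreover have "integrable ?N V" using V(1) by (simp add: integrable_abs_iff)
  ultimately show "graphon M V" by (simp add: graphon_def)
qed

lemma graphon_midpoint:
  assumes "graphon M f" "graphon M g"
  shows "graphon M (\<lambda>z. (f z + g z) / 2)"
proof -
  have "AE z in M \<Otimes>\<^sub>M M. f z = f (snd z, fst z)" "AE z in M \<Otimes>\<^sub>M M. g z = g (snd z, fst z)"
    using assms by (auto simp: graphon_def)
  then have "AE z in M \<Otimes>\<^sub>M M. (f z + g z) / 2 = (f (snd z, fst z) + g (snd z, fst z)) / 2"
    by eventually_elim simp
  then show ?thesis using assms by (simp add: graphon_def)
qed

section \<open>Completeness of the classes of graphons\<close>

\<comment> \<open>The flag \<open>s\<close> switches the sign condition on, so that all three parts are instances.\<close>
definition Wpc_L1 :: "bool \<Rightarrow> 'a measure \<Rightarrow> ennreal \<Rightarrow> real \<Rightarrow> real \<Rightarrow> ('a \<times> 'a \<Rightarrow> real) set" where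
  "Wpc_L1 s M p C B = {W \<in> Wpc M p C. (s \<longrightarrow> (AE z in M \<Otimes>\<^sub>M M. 0 \<le> W z))
     \<and> (\<integral>z. \<bar>W z\<bar> \<partial>(M \<Otimes>\<^sub>M M)) \<le> B}"

text \<open>An instance of the abstract criterion: symmetry, sign, and the L^1 and L^p bounds all
  survive midpoints and a.e. limits, and p > 1 supplies uniform integrability.\<close>

lemma cut_complete_Wpc_L1:
  assumes M: "sigma_finite_measure M" and p: "1 < p"
  shows "cut_complete M (Wpc_L1 s M p C B)"
  unfolding cut_complete_def
proof (intro allI impI, elim conjE)
  fix Ws assume Ws: "\<forall>n. Ws n \<in> Wpc_L1 s M p C B" and cauchy: "cut_Cauchy M Ws"
  let ?N = "M \<Otimes>\<^sub>M M"
  have int: "integrable ?N f" and gr: "graphon M f" and Lp: "Lp_le ?N p f C"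
    and bd: "(\<integral>z. \<bar>f z\<bar> \<partial>?N) \<le> B" and pos: "s \<Longrightarrow> AE z in ?N. 0 \<le> f z"
    if "f \<in> Wpc_L1 s M p C B" for f
    using that by (auto simp: Wpc_L1_def Wpc_def graphon_def)
  show "\<exists>V\<in>Wpc_L1 s M p C B. cut_converges M Ws V"
  proof (rule cut_converges_in_midpoint_convex_closed[OF M int bd _ _ _ Ws[rule_format] cauchy])
    show "\<exists>K\<ge>0. \<forall>f\<in>Wpc_L1 s M p C B. (\<integral>z. max 0 (\<bar>f z\<bar> - K) \<partial>?N) \<le> e" if "0 < e" for e
      using Lp_le_uniformly_integrable[OF p that, of ?N C] int Lp by blast
    show "(\<lambda>z. (f z + g z) / 2) \<in> Wpc_L1 s M p C B"
      if f: "f \<in> Wpc_L1 s M p C B" and g: "g \<in> Wpc_L1 s M p C B" for f g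
    proof -
      have "(\<integral>z. \<bar>(f z + g z) / 2\<bar> \<partial>?N) \<le> (\<integral>z. (\<bar>f z\<bar> + \<bar>g z\<bar>) / 2 \<partial>?N)"
        using int[OF f] int[OF g] by (intro integral_mono) auto
      also have "\<dots> \<le> B" using int[OF f] int[OF g] bd[OF f] bd[OF g] by simp
      finally have "(\<integral>z. \<bar>(f z + g z) / 2\<bar> \<partial>?N) \<le> B" .
      moreover have "AE z in ?N. 0 \<le> (f z + g z) / 2" if s
        using pos[OF f that] pos[OF g that] by eventually_elim simp
      ultimately show ?thesis
        using graphon_midpoint[OF gr gr, OF f g] Lp_le_midpoint[OF _ _ p Lp Lp, OF _ _ f g] int[OF f] int[OF g]
        by (simp add: Wpc_L1_def Wpc_def)
    qed
    show "V \<in> Wpc_L1 s M p C B"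
      if g: "\<And>k. g k \<in> Wpc_L1 s M p C B" and V: "V \<in> borel_measurable ?N"
        and lim: "AE z in ?N. (\<lambda>k. g k z) \<longlonglongrightarrow> V z" for g V
    proof -
      have "AE z in ?N. 0 \<le> V z" if s
      proof -
        have "AE z in ?N. \<forall>k. 0 \<le> g k z" using pos[OF g that] by (simp add: AE_all_countable)
        with lim show ?thesis by eventually_elim (auto intro: LIMSEQ_le_const)
      qed
      moreover have "Lp_le ?N p V C"
        using int[OF g] by (intro Lp_le_AE_limit[OF _ V p Lp[OF g] lim]) auto
      ultimately show ?thesis
        using graphon_AE_limit[OF M gr[OF g] V lim bd[OF g]] by (simp add: Wpc_L1_def Wpc_def)
    qed
  qed
qed

lemma cut_rel_complete_subset:
  assumes "cut_complete M A" "D \<subseteq> A" "\<And>W. W \<in> A \<Longrightarrow> graphon M W"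
  shows "cut_rel_complete M D"
  using assms unfolding cut_complete_def cut_rel_complete_def by (meson subsetD)

text \<open>Each Cauchy sequence supplies its own L^1 bound \<open>B\<close>: its integrals over the
  whole square form a Cauchy sequence of reals, hence a bounded one. The sequence then lives in
  \<open>Wpc_L1 True M p C B\<close>.\<close>

lemma cut_complete_nonneg_Wpc:
  assumes M: "sigma_finite_measure M" and p: "1 < p"
  shows "cut_complete M {W \<in> Wpc M p C. AE z in M \<Otimes>\<^sub>M M. 0 \<le> W z}" (is "cut_complete M ?A")
  unfolding cut_complete_def
proof (intro allI impI, elim conjE)
  fix Ws assume Ws: "\<forall>n. Ws n \<in> ?A" and cauchy: "cut_Cauchy M Ws"
  let ?N = "M \<Otimes>\<^sub>M M"
  have int: "integrable ?N (Ws n)" and pos: "AE z in ?N. 0 \<le> Ws n z" for n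
    using Ws by (auto simp: Wpc_def graphon_def)
  \<comment> \<open>For nonnegative functions the whole square already tests the \<open>L\<^sup>1\<close> norm.\<close>
  have "\<bar>(\<integral>z. Ws m z \<partial>?N) - (\<integral>z. Ws n z \<partial>?N)\<bar> < e"
    if "cut_norm M (\<lambda>z. Ws m z - Ws n z) < ennreal e" for m n e
  proof -
    have "ennreal \<bar>set_lebesgue_integral ?N (space M \<times> space M) (\<lambda>z. Ws m z - Ws n z)\<bar>
        \<le> cut_norm M (\<lambda>z. Ws m z - Ws n z)"
      unfolding cut_norm_def
      by (rule SUP_upper2[of "(space M, space M)"]) auto
    with that have "ennreal \<bar>set_lebesgue_integral ?N (space ?N) (\<lambda>z. Ws m z - Ws n z)\<bar> < ennreal e"
      unfolding space_pair_measure by (rule le_less_trans[rotated])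
    then show ?thesis
      using int by (simp add: set_integral_space ennreal_less_iff)
  qed
  then have "Cauchy (\<lambda>n. \<integral>z. Ws n z \<partial>?N)"
    using cauchy unfolding cut_Cauchy_def Cauchy_def dist_real_def by meson
  then obtain B where B: "\<And>n. \<bar>\<integral>z. Ws n z \<partial>?N\<bar> \<le> B"
    using Cauchy_Bseq BseqE by (metis real_norm_def)
  have "(\<integral>z. \<bar>Ws n z\<bar> \<partial>?N) \<le> B" for n
  proof -
    have "AE z in ?N. \<bar>Ws n z\<bar> = Ws n z" using pos[of n] by eventually_elim simp
    then have "(\<integral>z. \<bar>Ws n z\<bar> \<partial>?N) = (\<integral>z. Ws n z \<partial>?N)"
      using int[of n] by (intro integral_cong_AE) auto
    with B[of n] show ?thesis by simp
  qed
  then have "\<forall>n. Ws n \<in> Wpc_L1 True M p C B" using Ws by (simp add: Wpc_L1_def)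
  with cut_complete_Wpc_L1[OF M p] cauchy obtain V
    where "V \<in> Wpc_L1 True M p C B" "cut_converges M Ws V"
    unfolding cut_complete_def by meson
  then show "\<exists>V\<in>?A. cut_converges M Ws V" by (auto simp: Wpc_L1_def)
qed

lemma cut_complete_L1_Wpc:
  assumes M: "sigma_finite_measure M" and p: "1 < p"
  shows "cut_complete M {W \<in> Wpc M p C. (\<integral>z. \<bar>W z\<bar> \<partial>(M \<Otimes>\<^sub>M M)) \<le> C1}"
  using cut_complete_Wpc_L1[OF M p, of False C C1] by (simp add: Wpc_L1_def)

text \<open>Integrating |W| \<le> K + (|W| - K)^+, with \<open>K\<close> the uniform-integrability
  threshold for excess 1, bounds the L^1 norm by K times the total mass plus 1, so the L^1
  constraint holds automatically.\<close>

lemma cut_complete_Wpc_finite: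
  assumes M: "sigma_finite_measure M" and p: "1 < p" and fin: "emeasure M (space M) < \<infinity>"
  shows "cut_complete M (Wpc M p C)"
proof -
  let ?N = "M \<Otimes>\<^sub>M M"
  interpret M: sigma_finite_measure M by fact
  have "emeasure ?N (space ?N) < \<infinity>"
    using fin by (simp add: space_pair_measure M.emeasure_pair_measure_Times ennreal_mult_less_top)
  then interpret N: finite_measure ?N by (intro finite_measureI) auto
  obtain K where K: "0 \<le> K" "\<And>f. integrable ?N f \<Longrightarrow> Lp_le ?N p f C \<Longrightarrow> (\<integral>z. max 0 (\<bar>f z\<bar> - K) \<partial>?N) \<le> 1"
    using Lp_le_uniformly_integrable[OF p zero_less_one] by metis
  have "(\<integral>z. \<bar>W z\<bar> \<partial>?N) \<le> K * measure ?N (space ?N) + 1" if "W \<in> Wpc M p C" for W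
  proof -
    have W: "integrable ?N W" "Lp_le ?N p W C" using that by (auto simp: Wpc_def graphon_def)
    have "(\<integral>z. \<bar>W z\<bar> \<partial>?N) \<le> (\<integral>z. K + max 0 (\<bar>W z\<bar> - K) \<partial>?N)"
      using W(1) integrable_excess[OF W(1) K(1)] by (intro integral_mono) auto
    also have "\<dots> \<le> K * measure ?N (space ?N) + 1"
      using integrable_excess[OF W(1) K(1)] K(2)[OF W] by simp
    finally show ?thesis .
  qed
  then have "Wpc M p C = Wpc_L1 False M p C (K * measure ?N (space ?N) + 1)"
    by (auto simp: Wpc_L1_def)
  then show ?thesis using cut_complete_Wpc_L1[OF M p] by simp
qed

theorem mainTheorem9:
  fixes M :: "'a measure" and p :: ennreal and C :: real
  assumes "sigma_finite_measure M" and "1 < p"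
  shows
    "cut_complete M {W \<in> Wpc M p C. AE z in M \<Otimes>\<^sub>M M. 0 \<le> W z}
     \<and> (\<forall>A. (\<forall>W\<in>A. graphon M W \<and> (AE z in M \<Otimes>\<^sub>M M. 0 \<le> W z))
            \<and> (\<exists>C'. \<forall>W\<in>A. Lp_le (M \<Otimes>\<^sub>M M) p W C')
          \<longrightarrow> cut_rel_complete M A)
     \<and> cut_complete M {W. graphon M W \<and> (AE z in M \<Otimes>\<^sub>M M. 0 \<le> W z \<and> W z \<le> 1)}
     \<and> (\<forall>C1. cut_complete M {W \<in> Wpc M p C. (\<integral>z. \<bar>W z\<bar> \<partial>(M \<Otimes>\<^sub>M M)) \<le> C1})
     \<and> (\<forall>A. (\<forall>W\<in>A. graphon M W)
            \<and> (\<exists>C1. \<forall>W\<in>A. (\<integral>z. \<bar>W z\<bar> \<partial>(M \<Otimes>\<^sub>M M)) \<le> C1)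
            \<and> (\<exists>C'. \<forall>W\<in>A. Lp_le (M \<Otimes>\<^sub>M M) p W C')
          \<longrightarrow> cut_rel_complete M A)
     \<and> (emeasure M (space M) < \<infinity> \<longrightarrow>
          cut_complete M (Wpc M p C)
          \<and> (\<forall>A. (\<forall>W\<in>A. graphon M W) \<and> (\<exists>C'. \<forall>W\<in>A. Lp_le (M \<Otimes>\<^sub>M M) p W C')
                \<longrightarrow> cut_rel_complete M A))"
proof (intro conjI allI impI; (elim conjE exE)?)
  note M = assms(1) and p = assms(2)
  show "cut_complete M {W \<in> Wpc M p C. AE z in M \<Otimes>\<^sub>M M. 0 \<le> W z}"
    using M p by (rule cut_complete_nonneg_Wpc)
  \<comment> \<open>A bounded set lies in the complete class taken with its own bound
    \<open>C'\<close>, which is unrelated to \<open>C\<close>; the later relative statements follow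
    in the same way.\<close>
  show "cut_rel_complete M A"
    if "\<forall>W\<in>A. graphon M W \<and> (AE z in M \<Otimes>\<^sub>M M. 0 \<le> W z)" "\<forall>W\<in>A. Lp_le (M \<Otimes>\<^sub>M M) p W C'" for A C'
    using that by (intro cut_rel_complete_subset[OF cut_complete_nonneg_Wpc[OF M p, of C']])
      (auto simp: Wpc_def)
  \<comment> \<open>The [0,1]-valued graphons are the nonnegative part of the unit ball of
    L^\<infinity>, so the exponent here is \<infinity>, whatever the given p.\<close>
  have "{W. graphon M W \<and> (AE z in M \<Otimes>\<^sub>M M. 0 \<le> W z \<and> W z \<le> 1)}
      = {W \<in> Wpc M \<infinity> 1. AE z in M \<Otimes>\<^sub>M M. 0 \<le> W z}"
    by (auto simp: Wpc_def Lp_le_def)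
  then show "cut_complete M {W. graphon M W \<and> (AE z in M \<Otimes>\<^sub>M M. 0 \<le> W z \<and> W z \<le> 1)}"
    using cut_complete_nonneg_Wpc[OF M, of \<infinity> 1] by simp
  show "cut_complete M {W \<in> Wpc M p C. (\<integral>z. \<bar>W z\<bar> \<partial>(M \<Otimes>\<^sub>M M)) \<le> C1}" for C1
    using M p by (rule cut_complete_L1_Wpc)
  show "cut_rel_complete M A"
    if "\<forall>W\<in>A. graphon M W" "\<forall>W\<in>A. (\<integral>z. \<bar>W z\<bar> \<partial>(M \<Otimes>\<^sub>M M)) \<le> C1"
      "\<forall>W\<in>A. Lp_le (M \<Otimes>\<^sub>M M) p W C'" for A C1 C'
    using that by (intro cut_rel_complete_subset[OF cut_complete_L1_Wpc[OF M p, of C' C1]])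
      (auto simp: Wpc_def)
  assume fin: "emeasure M (space M) < \<infinity>"
  show "cut_complete M (Wpc M p C)"
    using M p fin by (rule cut_complete_Wpc_finite)
  show "cut_rel_complete M A"
    if "\<forall>W\<in>A. graphon M W" "\<forall>W\<in>A. Lp_le (M \<Otimes>\<^sub>M M) p W C'" for A C'
    using that by (intro cut_rel_complete_subset[OF cut_complete_Wpc_finite[OF M p fin, of C']])
      (auto simp: Wpc_def)
qed

end
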